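(* Let $$\varphi_{SG}(z)=\frac{2}{1+e^{-z}},\qquad \varphi_R(z)=1+\frac{z(1+\sqrt2+z)}{(1+\sqrt2)(1+\sqrt2-z)},\qquad z\in\mathbb D.$$ Then the sharp $\mathcal S^*(\varphi_R)$-radius of $\mathcal S^*(\varphi_{SG})$ is $$R_{\mathcal S^*(\varphi_R)}(\mathcal S^*(\varphi_{SG}))=\tfrac12\log2.$$
   Context: Let $\mathbb D=\{z\in\mathbb C:|z|<1\}$ and let $\mathcal A$ be the class of functions $f$ analytic on $\mathbb D$ with $f(0)=0$ and $f'(0)=1$. For an analytic function $\varphi$ on $\mathbb D$ with $\varphi(0)=1$, the class $\mathcal S^*(\varphi)$ consists of all $f\in\mathcal A$ with $zf'(z)/f(z)\prec\varphi(z)$; that is, there is an analytic $\omega:\mathbb D\to\mathbb D$ with $\omega(0)=0$ such that $zf'(z)/f(z)=\varphi(\omega(z))$ on $\mathbb D$ (the quotient takes the value $1$ at $z=0$, and $f$ has no other zeros). For two such functions $\varphi_1,\varphi_2$, the sharp $\mathcal S^*(\varphi_2)$-radius of $\mathcal S^*(\varphi_1)$ is $$R_{\mathcal S^*(\varphi_2)}(\mathcal S^*(\varphi_1))=\sup\left\{r\in(0,1]: f_r(z)=\tfrac{f(rz)}{r}\text{ belongs to }\mathcal S^*(\varphi_2)\text{ for every } f\in\mathcal S^*(\varphi_1)\right\}.$$ *)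

theory Defs
  imports "HOL-Complex_Analysis.Complex_Analysis"
begin

abbreviation unit_disc :: "complex set" where
  "unit_disc \<equiv> ball 0 1"

definition class_A :: "(complex \<Rightarrow> complex) set" where
  "class_A = {f. f holomorphic_on unit_disc \<and> f 0 = 0 \<and> deriv f 0 = 1}"

definition subordinate :: "(complex \<Rightarrow> complex) \<Rightarrow> (complex \<Rightarrow> complex) \<Rightarrow> bool" where
  "subordinate F G \<longleftrightarrow>
     (\<exists>\<omega>. \<omega> holomorphic_on unit_disc \<and> \<omega> ` unit_disc \<subseteq> unit_disc \<and> \<omega> 0 = 0 \<and>
          (\<forall>z\<in>unit_disc. F z = G (\<omega> z)))"

text \<open>The quotient z f'(z) / f(z) with its removable singularity at 0 filled in
  (its limit there is 1 for f in \<^term>\<open>class_A\<close>).\<close>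

definition star_quotient :: "(complex \<Rightarrow> complex) \<Rightarrow> complex \<Rightarrow> complex" where
  "star_quotient f z = (if z = 0 then 1 else z * deriv f z / f z)"

text \<open>The absence of zeros other than 0 is part of the quotient being defined on the disc;
  it is demanded explicitly because division by zero is total in HOL.\<close>

definition starlike_class :: "(complex \<Rightarrow> complex) \<Rightarrow> (complex \<Rightarrow> complex) set" where
  "starlike_class \<phi> =
     {f \<in> class_A. (\<forall>z\<in>unit_disc - {0}. f z \<noteq> 0) \<and> subordinate (star_quotient f) \<phi>}"

definition starlike_radius ::
    "(complex \<Rightarrow> complex) \<Rightarrow> (complex \<Rightarrow> complex) \<Rightarrow> real" where
  "starlike_radius \<phi>2 \<phi>1 =
     Sup {r :: real. 0 < r \<and> r \<le> 1 \<and>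
            (\<forall>f\<in>starlike_class \<phi>1.
               (\<lambda>z. f (of_real r * z) / of_real r) \<in> starlike_class \<phi>2)}"

definition phi_SG :: "complex \<Rightarrow> complex" where
  "phi_SG z = 2 / (1 + exp (- z))"

definition phi_R :: "complex \<Rightarrow> complex" where
  "phi_R z = 1 + z * (1 + of_real (sqrt 2) + z) /
                   ((1 + of_real (sqrt 2)) * (1 + of_real (sqrt 2) - z))"

text \<open>Both functions satisfy the standing assumptions on the parameter \<phi>: analytic on the
  disc, with value 1 at 0; in particular the denominators do not vanish there.\<close>

lemma phi_SG_0: "phi_SG 0 = 1"
  by (simp add: phi_SG_def)

lemma phi_R_0: "phi_R 0 = 1"
  by (simp add: phi_R_def)

lemma phi_SG_holomorphic: "phi_SG holomorphic_on unit_disc"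
proof -
  have "1 + exp (- z) \<noteq> 0" if "z \<in> unit_disc" for z :: complex
  proof
    assume "1 + exp (- z) = 0"
    then have e: "exp (- z) = -1"
      by (simp add: add_eq_0_iff)
    have "cos (Im z) > 0"
    proof (rule cos_gt_zero_pi)
      have "\<bar>Im z\<bar> < 1"
        using that abs_Im_le_cmod[of z] by simp
      then show "- (pi / 2) < Im z" "Im z < pi / 2"
        using pi_gt3 by linarith+
    qed
    then have "Re (exp (- z)) > 0"
      by (simp add: Re_exp)
    with e show False by simp
  qed
  then show ?thesis
    unfolding phi_SG_def by (intro holomorphic_intros) auto
qed

lemma phi_R_holomorphic: "phi_R holomorphic_on unit_disc"
proof -
  define k :: real where "k = 1 + sqrt 2"
  have k: "(1 + of_real (sqrt 2) :: complex) = of_real k"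
    by (simp add: k_def)
  have k1: "k > 1"
    by (simp add: k_def)
  have "of_real k * (of_real k - z) \<noteq> 0" if "z \<in> unit_disc" for z :: complex
  proof -
    have "z \<noteq> of_real k"
      using that k1 by auto
    then show ?thesis
      using k1 by simp
  qed
  then show ?thesis
    unfolding phi_R_def k by (intro holomorphic_intros) auto
qed

end

theory Submission
  imports Defs
begin

text \<open>
  Write \<open>\<kappa> = 1 + sqrt 2\<close> and \<open>\<rho> = ln 2 / 2\<close>. The equation \<open>phi_R \<zeta> = 1 + v\<close> is quadratic in
  \<open>\<zeta>\<close> with discriminant a multiple of \<open>(v + \<kappa>\<^sup>-\<^sup>2) (v + \<kappa>\<^sup>2)\<close>. For \<open>norm w < \<rho>\<close> and
  \<open>v = phi_SG w - 1\<close> one has \<open>Re v > - \<kappa>\<^sup>-\<^sup>2\<close>, because \<open>exp (- w)\<close> stays in the disc of radius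
  \<open>sqrt 2 - 1\<close> around 1; so the root vanishing at \<open>v = 0\<close> is a holomorphic function of \<open>w\<close>. It never
  meets the unit circle, since on that circle \<open>phi_R - 1\<close> has real part at most \<open>- \<kappa>\<^sup>-\<^sup>2\<close> or
  modulus at least \<open>\<kappa>\<^sup>-\<^sup>1\<close>. Hence \<open>phi_SG\<close> factors through \<open>phi_R\<close> on the disc of radius \<open>\<rho>\<close>.
  The radius cannot be larger: \<open>phi_SG (- \<rho>) = 1 - \<kappa>\<^sup>-\<^sup>2\<close>, and \<open>phi_R\<close> takes no real value below
  \<open>1 - \<kappa>\<^sup>-\<^sup>2\<close> (and above 0) in the unit disc, whereas some \<open>f\<close> has \<open>z f'(z) / f(z) = phi_SG z\<close>.
\<close>

section \<open>Exponential bounds and the image of a small disc under \<open>phi_SG\<close>\<close>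

text \<open>Termwise comparison of the exponential series with the constant term removed.\<close>

lemma norm_exp_minus_1_le:
  fixes z :: "'a::{real_normed_field,banach}"
  shows "norm (exp z - 1) \<le> exp (norm z) - 1"
proof -
  have tail: "(\<lambda>n. x ^ Suc n /\<^sub>R fact (Suc n)) sums (exp x - 1)"
    for x :: "'b::{real_normed_field,banach}"
    using exp_converges[of x] by (subst sums_Suc_iff) simp
  have eq: "norm (z ^ Suc n /\<^sub>R fact (Suc n)) = norm z ^ Suc n /\<^sub>R fact (Suc n)" for n
    by (simp add: norm_mult norm_power del: fact_Suc)
  have "summable (\<lambda>n. norm (z ^ Suc n /\<^sub>R fact (Suc n)))"
    unfolding eq using tail[of "norm z"] by (rule sums_summable)
  from summable_norm[OF this] show ?thesis
    unfolding eq using tail[of z] tail[of "norm z"] by (simp add: sums_iff del: fact_Suc)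
qed

lemma exp_half_ln2: "exp (ln 2 / 2) = sqrt 2"
proof -
  have "exp (ln 2 / 2) ^ 2 = (2::real)"
    by (simp flip: exp_double)
  then show ?thesis
    by (metis exp_ge_zero real_sqrt_unique)
qed

lemma sqrt2_bounds: "sqrt 2 > 141/100" "sqrt 2 < 142/100"
  by (rule real_less_rsqrt real_less_lsqrt; simp add: power2_eq_square)+

text \<open>Everything follows from \<open>exp (- w)\<close> lying within
  \<open>sqrt 2 - 1 = exp (ln 2 / 2) - 1\<close> of 1; this is where the radius
  \<open>ln 2 / 2\<close> enters.\<close>

lemma phi_SG_estimates:
  assumes "norm w < ln 2 / 2"
  shows "1 + exp (- w) \<noteq> 0" "Re (phi_SG w) > 2 * sqrt 2 - 2" "norm (phi_SG w - 1) < sqrt 2 - 1"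
proof -
  define s where "s = sqrt 2"
  have s: "s\<^sup>2 = 2" "s > 141/100" "s < 142/100"
    using sqrt2_bounds by (simp_all add: s_def)
  define E where "E = exp (- w)"
  have d: "norm (E - 1) < s - 1"
  proof -
    have "norm (E - 1) \<le> exp (norm w) - 1"
      unfolding E_def using norm_exp_minus_1_le[of "- w"] by simp
    also have "\<dots> < exp (ln 2 / 2) - 1"
      using assms by simp
    finally show ?thesis
      by (simp add: exp_half_ln2 s_def)
  qed
  have "norm (1 + E) \<ge> 2 - norm (E - 1)"
    using norm_triangle_ineq2[of 2 "1 - E"] by (simp add: norm_minus_commute algebra_simps)
  then have n: "norm (1 + E) > 3 - s"
    using d by linarith
  then show nz: "1 + exp (- w) \<noteq> 0"
    using s by (auto simp: E_def)
  have v: "phi_SG w - 1 = (1 - E) / (1 + E)"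
    using nz by (simp add: phi_SG_def E_def field_simps)
  have "norm (1 - E) < (s - 1) * norm (1 + E)"
  proof -
    have "s - 1 = (s - 1) * 1" by simp
    also have "\<dots> < (s - 1) * norm (1 + E)"
      using n s by (intro mult_strict_left_mono) auto
    finally show ?thesis
      using d by (simp add: norm_minus_commute)
  qed
  then show "norm (phi_SG w - 1) < sqrt 2 - 1"
    using nz by (simp add: v norm_divide divide_less_eq E_def s_def)
  \<comment> \<open>The half-plane Re > 2s - 2 pulls back under E -> 2 / (1 + E) to the disc with
    diameter from -1 to s, that is, centre \<open>a\<close> and radius (s + 1) / 2. The disc of
    radius s - 1 around 1 lies inside it, tangent at s.\<close>
  define a where "a = (s - 1) / 2"
  have "norm (E - of_real a) < (s + 1) / 2"
  proof -
    have "norm (E - of_real a) \<le> norm (E - 1) + norm (1 - of_real a :: complex)"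
      by norm
    also have "norm (1 - of_real a :: complex) = \<bar>1 - a\<bar>"
      by (metis norm_of_real of_real_1 of_real_diff)
    finally show ?thesis
      using d s by (simp add: a_def field_simps)
  qed
  then have "(norm (E - of_real a))\<^sup>2 < ((s + 1) / 2)\<^sup>2"
    by (intro power_strict_mono) auto
  also have "(norm (E - of_real a))\<^sup>2 = (Re E - a)\<^sup>2 + (Im E)\<^sup>2"
    by (simp add: cmod_power2)
  finally have disc: "(Re E)\<^sup>2 + (Im E)\<^sup>2 < (s - 1) * Re E + s"
    by (simp add: a_def power2_eq_square field_simps)
  have "(2 * s - 2) * ((1 + Re E)\<^sup>2 + (Im E)\<^sup>2) < 2 * (1 + Re E)"
  proof -
    have "(2 * s - 2) * ((1 + Re E)\<^sup>2 + (Im E)\<^sup>2)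
        < (2 * s - 2) * (1 + 2 * Re E + ((s - 1) * Re E + s))"
      using disc s by (intro mult_strict_left_mono) (auto simp: power2_eq_square algebra_simps)
    also have "\<dots> = 2 * (s\<^sup>2 - 1) * (1 + Re E)"
      by (simp add: power2_eq_square algebra_simps)
    finally show ?thesis
      using s by simp
  qed
  moreover have "(1 + Re E)\<^sup>2 + (Im E)\<^sup>2 > 0"
    using nz by (metis E_def cmod_power2 complex_mod_sqrt_Re_mult_cnj norm_eq_zero one_complex.sel plus_complex.sel
        zero_less_power2 add_0)
  ultimately show "Re (phi_SG w) > 2 * sqrt 2 - 2"
    by (simp add: phi_SG_def Re_divide E_def[symmetric] s_def[symmetric] less_divide_eq)
qed

section \<open>Boundary values of \<open>phi_R\<close> and the factorization\<close>

text \<open>For Re \<zeta> \<ge> 0 the point \<zeta> is no nearer to -\<kappa> than to \<kappa>,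
  which bounds the modulus of \<open>phi_R \<zeta> - 1\<close> below by 1 / \<kappa> = sqrt 2 - 1.
  For Re \<zeta> < 0 the real part is an explicit rational function of Re \<zeta>. Each alternative
  contradicts a bound in \<open>phi_SG_estimates\<close>.\<close>

lemma phi_R_on_unit_circle:
  assumes "norm \<zeta> = 1"
  shows "Re (phi_R \<zeta>) \<le> 2 * sqrt 2 - 2 \<or> norm (phi_R \<zeta> - 1) \<ge> sqrt 2 - 1"
proof -
  define s where "s = sqrt 2"
  have s: "s\<^sup>2 = 2" "s > 141/100" "s < 142/100"
    using sqrt2_bounds by (simp_all add: s_def)
  define u y where "u = Re \<zeta>" and "y = Im \<zeta>"
  have uy: "u\<^sup>2 + y\<^sup>2 = 1"
    using assms by (metis cmod_power2 power_one u_def y_def)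
  then have u1: "- 1 \<le> u" "u \<le> 1"
    using assms abs_Re_le_cmod[of \<zeta>] by (auto simp: u_def)
  define N D where "N = \<zeta> * (1 + of_real s + \<zeta>)" and "D = (1 + of_real s) * (1 + of_real s - \<zeta>)"
  have v: "phi_R \<zeta> = 1 + N / D"
    by (simp add: phi_R_def N_def D_def s_def)
  have D0: "D \<noteq> 0"
  proof -
    have "Re (1 + of_real s - \<zeta>) > 0"
      using u1 s by (simp add: u_def)
    then show ?thesis
      using s by (auto simp: D_def complex_eq_iff)
  qed
  have k: "norm (1 + of_real s :: complex) = 1 + s"
    using s by (metis abs_of_nonneg add_nonneg_nonneg norm_of_real of_real_1 of_real_add zero_le_one
        less_eq_real_def order_less_trans zero_less_divide_iff zero_less_numeral)
  show ?thesis
  proof (cases "u \<ge> 0")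
    case True
    have "norm (1 + of_real s - \<zeta>) \<le> norm (1 + of_real s + \<zeta>)"
      using True s by (auto simp: cmod_def u_def[symmetric] y_def[symmetric] power2_eq_square algebra_simps)
    moreover have "norm N = norm (1 + of_real s + \<zeta>)" "norm D = (1 + s) * norm (1 + of_real s - \<zeta>)"
      using assms by (simp_all add: N_def D_def norm_mult k)
    moreover have "(s - 1) * (1 + s) = 1"
      using s by (simp add: algebra_simps power2_eq_square)
    ultimately have "(s - 1) * norm D \<le> norm N"
      by (metis mult.assoc mult_1)
    then have "norm (phi_R \<zeta> - 1) \<ge> s - 1"
      using D0 by (simp add: v norm_divide le_divide_eq)
    then show ?thesis
      by (simp add: s_def)
  next
    case False
    have y2: "y * y = 1 - u * u" and ss: "s * s = 2"
      using uy s by (simp_all add: power2_eq_square)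
    have Dsq: "(Re D)\<^sup>2 + (Im D)\<^sup>2 = (1 + s)\<^sup>2 * ((1 + s)\<^sup>2 + 1 - 2 * (1 + s) * u)"
    proof -
      have "(Re D)\<^sup>2 + (Im D)\<^sup>2 = (1 + s)\<^sup>2 * ((1 + s - u)\<^sup>2 + y\<^sup>2)"
        by (simp add: D_def u_def y_def power2_eq_square algebra_simps)
      also have "(1 + s - u)\<^sup>2 + y\<^sup>2 = (1 + s)\<^sup>2 + 1 - 2 * (1 + s) * u"
        using uy by (simp add: power2_eq_square algebra_simps)
      finally show ?thesis .
    qed
    have ND: "Re N * Re D + Im N * Im D = (1 + s)\<^sup>2 * (2 * (u\<^sup>2 + u - 1))"
    proof -
      have parts: "Re N = u * (1 + s + u) - y * y" "Im N = u * y + y * (1 + s + u)"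
           "Re D = (1 + s) * (1 + s - u)" "Im D = - ((1 + s) * y)"
        by (simp_all add: N_def D_def u_def y_def)
      have "Re N * Re D + Im N * Im D
          = (1 + s) * ((u * (1 + s + u) - y * y) * (1 + s - u) - (y * y) * (u + (1 + s + u)))"
        unfolding parts by (simp add: algebra_simps)
      also have "\<dots> = (1 + s) * (((1 + s)\<^sup>2 - 1) * u - (1 + s) + (1 + s) * (2 * u\<^sup>2 - 1))"
        unfolding y2 by (simp add: power2_eq_square algebra_simps)
      also have "(1 + s)\<^sup>2 - 1 = 2 * (1 + s)"
        by (simp add: power2_eq_square algebra_simps ss)
      also have "(1 + s) * (2 * (1 + s) * u - (1 + s) + (1 + s) * (2 * u\<^sup>2 - 1))
          = (1 + s)\<^sup>2 * (2 * (u\<^sup>2 + u - 1))"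
        by (simp add: power2_eq_square algebra_simps)
      finally show ?thesis .
    qed
    have "Re (N / D) = (2 * (u\<^sup>2 + u - 1)) / ((1 + s)\<^sup>2 + 1 - 2 * (1 + s) * u)"
      unfolding Re_divide Dsq ND using s by simp
    also have "\<dots> \<le> 2 * s - 3"
    proof -
      have pos: "(1 + s)\<^sup>2 + 1 - 2 * (1 + s) * u > 0"
      proof -
        have "(1 + s) * u < 0"
          using False s by (simp add: mult_less_0_iff)
        moreover have "(1 + s)\<^sup>2 \<ge> 0" by simp
        ultimately show ?thesis by linarith
      qed
      \<comment> \<open>The bound is attained at u = -1, which explains the factor u + 1; the other
        root s - 1 is positive and so lies outside the present case.\<close>
      have "(2 * s - 3) * ((1 + s)\<^sup>2 + 1 - 2 * (1 + s) * u) - 2 * (u\<^sup>2 + u - 1)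
          = - 2 * ((u + 1) * (u - (s - 1)))"
      proof -
        have sss: "s * (s * x) = 2 * x" for x
          by (simp add: ss mult.assoc[symmetric])
        show ?thesis
          by (simp add: power2_eq_square algebra_simps ss sss)
      qed
      moreover have "(u + 1) * (u - (s - 1)) \<le> 0"
        using u1 False s by (intro mult_nonneg_nonpos) auto
      ultimately show ?thesis
        using pos by (simp add: divide_le_eq)
    qed
    finally show ?thesis
      by (simp add: v s_def)
  qed
qed

text \<open>The polynomial equation also excludes the pole of \<^const>\<open>phi_R\<close>, where division yields 0.\<close>

lemma phi_R_eq_iff:
  assumes "\<kappa> = 1 + of_real (sqrt 2)"
  shows "phi_R \<zeta> = 1 + v \<and> \<zeta> \<noteq> \<kappa> \<longleftrightarrow> \<zeta>\<^sup>2 + \<kappa> * (1 + v) * \<zeta> - \<kappa>\<^sup>2 * v = 0"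
proof -
  have k: "\<kappa> \<noteq> 0"
    using assms sqrt2_bounds by (auto simp: complex_eq_iff)
  show ?thesis
  proof (cases "\<zeta> = \<kappa>")
    case True
    have "\<kappa>\<^sup>2 + \<kappa> * (1 + v) * \<kappa> - \<kappa>\<^sup>2 * v = 2 * \<kappa>\<^sup>2"
      by (simp add: power2_eq_square algebra_simps)
    then show ?thesis
      unfolding True using k by (metis mult_eq_0_iff power_eq_0_iff zero_neq_numeral)
  next
    case False
    have "phi_R \<zeta> = 1 + v \<longleftrightarrow> \<zeta> * (\<kappa> + \<zeta>) = v * (\<kappa> * (\<kappa> - \<zeta>))"
      unfolding phi_R_def assms[symmetric] using False k by (simp add: divide_eq_eq)
    also have "\<dots> \<longleftrightarrow> \<zeta>\<^sup>2 + \<kappa> * (1 + v) * \<zeta> - \<kappa>\<^sup>2 * v = 0"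
      by (simp add: power2_eq_square algebra_simps)
    finally show ?thesis
      using False by simp
  qed
qed

text \<open>Composing \<Omega> with a Schwarz function whose values stay in the small disc turns
  subordination to \<open>phi_SG\<close> into subordination to \<open>phi_R\<close>.\<close>

lemma phi_SG_factors_through_phi_R:
  obtains \<Omega> where "\<Omega> holomorphic_on ball 0 (ln 2 / 2)" "\<Omega> ` ball 0 (ln 2 / 2) \<subseteq> unit_disc"
    "\<Omega> 0 = 0" "\<And>w. w \<in> ball 0 (ln 2 / 2) \<Longrightarrow> phi_SG w = phi_R (\<Omega> w)"
proof -
  define \<rho> :: real where "\<rho> = ln 2 / 2"
  define k where "k = 1 + sqrt 2"
  define \<kappa> :: complex where "\<kappa> = of_real k"
  have k: "k\<^sup>2 = 3 + 2 * sqrt 2" "1 / k\<^sup>2 = 3 - 2 * sqrt 2" "k > 0"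
  proof -
    show k2: "k\<^sup>2 = 3 + 2 * sqrt 2" and "k > 0"
      using sqrt2_bounds by (simp_all add: k_def power2_eq_square algebra_simps)
    have "(3 - 2 * sqrt 2) * (3 + 2 * sqrt 2) = 1"
      by (simp add: algebra_simps)
    then show "1 / k\<^sup>2 = 3 - 2 * sqrt 2"
      unfolding k2 using sqrt2_bounds by (subst divide_eq_eq) auto
  qed
  have \<kappa>: "\<kappa> = 1 + of_real (sqrt 2)" "\<kappa> \<noteq> 0"
    using k(3) by (simp add: \<kappa>_def k_def, simp only: \<kappa>_def of_real_eq_0_iff)
  define v where "v w = phi_SG w - 1" for w
  \<comment> \<open>A square root of (1 + v)^2 + 4 v = (v + 1 / k^2) (v + k^2), where k^2 + 1 / k^2
    = 6. Both factors have positive real part on the disc, so each principal root is holomorphic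
    there.\<close>
  define q where "q w = csqrt (v w + of_real (1 / k\<^sup>2)) * csqrt (v w + of_real (k\<^sup>2))" for w
  \<comment> \<open>The plus sign selects the root that is 0 at v = 0; the other root is -\<kappa>
    there.\<close>
  define \<Omega> where "\<Omega> w = \<kappa> / 2 * (q w - (1 + v w))" for w
  have vre: "Re (v w) + 1 / k\<^sup>2 > 0" "Re (v w) + k\<^sup>2 > 0" if "norm w < \<rho>" for w
    using phi_SG_estimates(2)[of w] that sqrt2_bounds k by (auto simp: v_def \<rho>_def)
  have holv: "v holomorphic_on ball 0 \<rho>"
    unfolding v_def phi_SG_def using phi_SG_estimates(1)
    by (intro holomorphic_intros) (auto simp: \<rho>_def)
  have hol: "\<Omega> holomorphic_on ball 0 \<rho>"
    unfolding \<Omega>_def q_def using vre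
    by (intro holomorphic_intros holv) (force simp: complex_nonpos_Reals_iff)+
  have zero: "\<Omega> 0 = 0"
  proof -
    have "csqrt (of_real (1 / k\<^sup>2)) = of_real (1 / k)" "csqrt (of_real (k\<^sup>2)) = of_real k"
      using k(3) by (subst csqrt_of_real_nonneg;
          simp add: real_sqrt_divide del: of_real_divide of_real_power)+
    then have "q 0 = 1"
      unfolding q_def v_def phi_SG_0 using k(3) by (simp del: of_real_power)
    then show ?thesis
      by (simp add: \<Omega>_def v_def phi_SG_0)
  qed
  have q2: "(q w)\<^sup>2 = (1 + v w)\<^sup>2 + 4 * v w" for w
  proof -
    have "(q w)\<^sup>2 = (v w + of_real (1 / k\<^sup>2)) * (v w + of_real (k\<^sup>2))"
      by (simp add: q_def power_mult_distrib)
    also have "\<dots> = (v w)\<^sup>2 + of_real (1 / k\<^sup>2 + k\<^sup>2) * v w + of_real (1 / k\<^sup>2 * k\<^sup>2)"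
      by (simp only: of_real_add of_real_mult) (simp add: power2_eq_square algebra_simps)
    also have "1 / k\<^sup>2 + k\<^sup>2 = 6"
      using k by linarith
    also have "1 / k\<^sup>2 * k\<^sup>2 = 1"
      using k(3) by simp
    finally show ?thesis
      by (simp add: power2_eq_square algebra_simps)
  qed
  have sol: "phi_SG w = phi_R (\<Omega> w)" for w
  proof -
    have "(\<Omega> w)\<^sup>2 + \<kappa> * (1 + v w) * \<Omega> w - \<kappa>\<^sup>2 * v w = \<kappa>\<^sup>2 / 4 * ((q w)\<^sup>2 - (1 + v w)\<^sup>2 - 4 * v w)"
      by (simp add: \<Omega>_def power2_eq_square field_simps)
    also have "\<dots> = 0"
      by (simp add: q2)
    finally have "phi_R (\<Omega> w) = 1 + v w"
      using phi_R_eq_iff[OF \<kappa>(1)] by blast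
    then show ?thesis
      by (simp add: v_def)
  qed
  have off_circle: "norm (\<Omega> w) \<noteq> 1" if "norm w < \<rho>" for w
    using phi_R_on_unit_circle[of "\<Omega> w"] phi_SG_estimates(2,3)[of w] that
    by (auto simp: sol \<rho>_def)
  have "norm (\<Omega> w) < 1" if "norm w < \<rho>" for w
  proof (rule ccontr)
    assume "\<not> norm (\<Omega> w) < 1"
    \<comment> \<open>By connectedness the modulus of \<Omega>, which is 0 at the origin, cannot
      reach 1 or more without taking the excluded value 1.\<close>
    moreover have "connected ((\<lambda>w. norm (\<Omega> w)) ` ball 0 \<rho>)"
      by (intro connected_continuous_image continuous_on_norm holomorphic_on_imp_continuous_on hol)
        simp
    moreover have "norm (\<Omega> 0) \<in> (\<lambda>w. norm (\<Omega> w)) ` ball 0 \<rho>"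
      by (intro imageI) (simp add: \<rho>_def)
    moreover have "norm (\<Omega> w) \<in> (\<lambda>w. norm (\<Omega> w)) ` ball 0 \<rho>"
      using that by (intro imageI) simp
    ultimately have "1 \<in> (\<lambda>w. norm (\<Omega> w)) ` ball 0 \<rho>"
      using connectedD_interval[of _ "norm (\<Omega> 0)" "norm (\<Omega> w)" 1] zero by auto
    then show False
      using off_circle by auto
  qed
  then have "\<Omega> ` ball 0 \<rho> \<subseteq> unit_disc"
    by auto
  with hol zero sol show ?thesis
    by (intro that) (simp_all add: \<rho>_def)
qed

section \<open>Omitted real values and the extremal function\<close>

text \<open>For a smaller positive \<open>a\<close> the real quadratic for \<zeta> has negative
  discriminant. Its roots are then conjugate with product k^2 (1 - a) > 1, so both lie outside the
  closed unit disc.\<close>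

lemma phi_R_real_value_bound:
  assumes "norm \<zeta> < 1" "0 < a" "phi_R \<zeta> = of_real a"
  shows "a \<ge> 2 * sqrt 2 - 2"
proof (rule ccontr)
  assume "\<not> a \<ge> 2 * sqrt 2 - 2"
  define k where "k = 1 + sqrt 2"
  define x where "x = 1 - a"
  have x: "3 - 2 * sqrt 2 < x" "x < 1"
    using \<open>\<not> _\<close> \<open>0 < a\<close> by (simp_all add: x_def)
  have k: "k\<^sup>2 = 3 + 2 * sqrt 2" "k > 0"
    using sqrt2_bounds by (simp_all add: k_def power2_eq_square algebra_simps)
  have kx: "k\<^sup>2 * x > 1"
  proof -
    have "k\<^sup>2 * (3 - 2 * sqrt 2) < k\<^sup>2 * x"
      using x k by (intro mult_strict_left_mono) auto
    then show ?thesis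
      by (simp add: k algebra_simps)
  qed
  \<comment> \<open>The roots in x are 3 - 2 sqrt 2 and 3 + 2 sqrt 2; positivity of \<open>a\<close>
    keeps x below the larger one.\<close>
  have disc: "(1 - x)\<^sup>2 - 4 * x < 0"
  proof -
    have "(x - (3 - 2 * sqrt 2)) * (x - (3 + 2 * sqrt 2)) < 0"
      using x sqrt2_bounds by (intro mult_pos_neg) auto
    then show ?thesis
      by (simp add: power2_eq_square algebra_simps)
  qed
  have ne: "\<zeta> \<noteq> of_real k"
  proof -
    have "k > 1"
      using sqrt2_bounds by (simp add: k_def)
    then show ?thesis
      using assms(1) by auto
  qed
  have "\<zeta>\<^sup>2 + of_real k * (1 + of_real (- x)) * \<zeta> - (of_real k)\<^sup>2 * of_real (- x) = 0"
    using phi_R_eq_iff[of "of_real k" \<zeta> "of_real (- x)"] ne assms(3)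
    by (simp add: k_def x_def)
  then have re: "(Re \<zeta>)\<^sup>2 - (Im \<zeta>)\<^sup>2 + k * (1 - x) * Re \<zeta> + k\<^sup>2 * x = 0"
    and im: "Im \<zeta> * (2 * Re \<zeta> + k * (1 - x)) = 0"
    by (simp_all add: complex_eq_iff power2_eq_square algebra_simps)
  show False
  proof (cases "Im \<zeta> = 0")
    case True
    \<comment> \<open>Completing the square: a real root would make a square equal to the negative
      discriminant.\<close>
    have "(2 * Re \<zeta> + k * (1 - x))\<^sup>2 = k\<^sup>2 * ((1 - x)\<^sup>2 - 4 * x)"
      using re True by (simp add: power2_eq_square algebra_simps)
    moreover have "k\<^sup>2 * ((1 - x)\<^sup>2 - 4 * x) < 0"
      using disc k(2) by (intro mult_pos_neg) auto
    ultimately show False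
      by (metis not_less zero_le_power2)
  next
    case False
    then have "k * (1 - x) = - 2 * Re \<zeta>"
      using im by auto
    then have "(norm \<zeta>)\<^sup>2 = k\<^sup>2 * x"
      using re unfolding cmod_power2 by (simp add: power2_eq_square)
    moreover have "(norm \<zeta>)\<^sup>2 < 1"
      using assms(1) by (simp add: abs_square_less_1)
    ultimately show False
      using kx by simp
  qed
qed

text \<open>The solution of \<open>z f' / f = \<phi>\<close> is \<open>f z = z exp (\<integral> (\<phi> - 1) / z)\<close>.\<close>

lemma starlike_class_extremal:
  assumes hol: "\<phi> holomorphic_on unit_disc" and "\<phi> 0 = 1"
  obtains f where "f \<in> starlike_class \<phi>" "\<And>z. z \<in> unit_disc \<Longrightarrow> star_quotient f z = \<phi> z"
proof -
  define g where "g z = (if z = 0 then deriv \<phi> 0 else (\<phi> z - \<phi> 0) / (z - 0))" for z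
  have "g holomorphic_on unit_disc"
    unfolding g_def using hol by (rule pole_lemma_open) simp
  then obtain F where F: "\<And>z. z \<in> unit_disc \<Longrightarrow> (F has_field_derivative g z) (at z within unit_disc)"
    using holomorphic_convex_primitive'[of unit_disc g] by auto
  have F': "(F has_field_derivative g z) (at z)" if "z \<in> unit_disc" for z
    using F[OF that] that by (metis at_within_open open_ball)
  \<comment> \<open>Subtracting \<open>F 0\<close> normalizes the derivative of \<open>f\<close> at
    0 to 1.\<close>
  define f where "f z = z * exp (F z - F 0)" for z
  have f': "(f has_field_derivative \<phi> z * exp (F z - F 0)) (at z)" if "z \<in> unit_disc" for z
  proof -
    have "\<phi> z = 1 + z * g z"
      using \<open>\<phi> 0 = 1\<close> by (simp add: g_def)
    then show ?thesis
      unfolding f_def using that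
      by (auto intro!: derivative_eq_intros F' simp: algebra_simps)
  qed
  have q: "star_quotient f z = \<phi> z" if "z \<in> unit_disc" for z
    using DERIV_imp_deriv[OF f'[OF that]] \<open>\<phi> 0 = 1\<close> by (simp add: star_quotient_def f_def)
  have "f holomorphic_on unit_disc"
    using f' holomorphic_on_open[of unit_disc f] by blast
  moreover have "deriv f 0 = 1"
    using DERIV_imp_deriv[OF f'[of 0]] \<open>\<phi> 0 = 1\<close> by simp
  moreover have "subordinate (star_quotient f) \<phi>"
    unfolding subordinate_def using q by (intro exI[of _ "\<lambda>z. z"]) auto
  ultimately have "f \<in> starlike_class \<phi>"
    by (auto simp: starlike_class_def class_A_def f_def)
  with q show ?thesis
    by (intro that)
qed

section \<open>Dilations and the two bounds for the radius\<close>

lemma has_field_derivative_dilation: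
  assumes "f holomorphic_on unit_disc" "0 < r" "r \<le> 1" "z \<in> unit_disc"
  shows "((\<lambda>z. f (of_real r * z) / of_real r) has_field_derivative deriv f (of_real r * z)) (at z)"
proof -
  have "of_real r * z \<in> unit_disc"
    using assms mult_le_one[of r "norm z"] mult_left_le_one_le[of "norm z" r]
    by (auto simp: norm_mult)
  then have "(f has_field_derivative deriv f (of_real r * z)) (at (of_real r * z))"
    using assms(1) by (intro holomorphic_derivI[of f unit_disc]) auto
  then have "((\<lambda>z. f (of_real r * z)) has_field_derivative deriv f (of_real r * z) * of_real r) (at z)"
    by (rule DERIV_chain'[rotated]) (auto intro!: derivative_eq_intros)
  from DERIV_cdivide[OF this, of "of_real r"] show ?thesis
    using assms(2) by simp
qed

lemma star_quotient_dilation: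
  assumes "f holomorphic_on unit_disc" "0 < r" "r \<le> 1" "z \<in> unit_disc"
  shows "star_quotient (\<lambda>z. f (of_real r * z) / of_real r) z = star_quotient f (of_real r * z)"
  using DERIV_imp_deriv[OF has_field_derivative_dilation[OF assms]] assms(2)
  by (simp add: star_quotient_def)

text \<open>The Schwarz lemma gives |\<omega>(r z)| \<le> |r z| < r, so \<omega>(r z) lies in the
  open disc where \<Omega> is available even when r = ln 2 / 2. The new Schwarz function is z ->
  \<Omega>(\<omega>(r z)).\<close>

lemma dilation_in_starlike_class:
  assumes r: "0 < r" "r \<le> ln 2 / 2" and f: "f \<in> starlike_class phi_SG"
  shows "(\<lambda>z. f (of_real r * z) / of_real r) \<in> starlike_class phi_R"
proof -
  have r1: "r \<le> 1"
    using r ln_2_less_1 by linarith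
  from f have hol: "f holomorphic_on unit_disc" and f0: "f 0 = 0" "deriv f 0 = 1"
    and nz: "\<And>z. z \<in> unit_disc - {0} \<Longrightarrow> f z \<noteq> 0"
    and sub: "subordinate (star_quotient f) phi_SG"
    by (auto simp: starlike_class_def class_A_def)
  from sub obtain \<omega> where \<omega>: "\<omega> holomorphic_on unit_disc" "\<omega> ` unit_disc \<subseteq> unit_disc" "\<omega> 0 = 0"
    "\<And>z. z \<in> unit_disc \<Longrightarrow> star_quotient f z = phi_SG (\<omega> z)"
    unfolding subordinate_def by blast
  obtain \<Omega> where \<Omega>: "\<Omega> holomorphic_on ball 0 (ln 2 / 2)" "\<Omega> ` ball 0 (ln 2 / 2) \<subseteq> unit_disc"
    "\<Omega> 0 = 0" "\<And>w. w \<in> ball 0 (ln 2 / 2) \<Longrightarrow> phi_SG w = phi_R (\<Omega> w)"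
    using phi_SG_factors_through_phi_R by blast
  have rz: "of_real r * z \<in> unit_disc" if "z \<in> unit_disc" for z
    using that r r1 mult_left_le_one_le[of "norm z" r] by (auto simp: norm_mult)
  have small: "\<omega> (of_real r * z) \<in> ball 0 (ln 2 / 2)" if "z \<in> unit_disc" for z
  proof -
    have "norm (\<omega> (of_real r * z)) \<le> norm (of_real r * z)"
      using \<omega> rz[OF that] by (intro Schwarz_Lemma(1)) (auto simp: image_subset_iff)
    also have "\<dots> < r"
      using that r by (simp add: norm_mult)
    finally show ?thesis
      using r by simp
  qed
  define h where "h z = f (of_real r * z) / of_real r" for z
  have h': "(h has_field_derivative deriv f (of_real r * z)) (at z)" if "z \<in> unit_disc" for z
    unfolding h_def using has_field_derivative_dilation[OF hol r(1) r1 that] .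
  have "h holomorphic_on unit_disc"
    using h' holomorphic_on_open[of unit_disc h] by blast
  moreover have "h 0 = 0" "deriv h 0 = 1"
    using DERIV_imp_deriv[OF h'[of 0]] f0 by (simp_all add: h_def)
  moreover have "h z \<noteq> 0" if "z \<in> unit_disc - {0}" for z
    using nz[of "of_real r * z"] rz[of z] that r by (simp add: h_def)
  moreover have "subordinate (star_quotient h) phi_R"
    unfolding subordinate_def
  proof (intro exI[of _ "\<lambda>z. \<Omega> (\<omega> (of_real r * z))"] conjI ballI)
    have "(\<lambda>z. \<omega> (of_real r * z)) holomorphic_on unit_disc"
      using rz by (intro holomorphic_on_compose_gen[OF _ \<omega>(1), unfolded o_def] holomorphic_intros) auto
    then show "(\<lambda>z. \<Omega> (\<omega> (of_real r * z))) holomorphic_on unit_disc"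
      using small by (intro holomorphic_on_compose_gen[OF _ \<Omega>(1), unfolded o_def]) auto
    show "(\<lambda>z. \<Omega> (\<omega> (of_real r * z))) ` unit_disc \<subseteq> unit_disc"
      using \<Omega>(2) small by blast
    show "\<Omega> (\<omega> (of_real r * 0)) = 0"
      using \<Omega>(3) \<omega>(3) by simp
    show "star_quotient h z = phi_R (\<Omega> (\<omega> (of_real r * z)))" if "z \<in> unit_disc" for z
      unfolding h_def star_quotient_dilation[OF hol r(1) r1 that]
      using \<omega>(4)[OF rz[OF that]] \<Omega>(4)[OF small[OF that]] by simp
  qed
  ultimately have "h \<in> starlike_class phi_R"
    by (simp add: starlike_class_def class_A_def)
  then show ?thesis
    by (simp add: h_def[abs_def])
qed

text \<open>For larger r, the dilation of the extremal function has a quotient taking a real value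
  that \<open>phi_R\<close> omits on the disc.\<close>

lemma radius_le:
  assumes r: "0 < r" "r \<le> 1"
    and star: "\<And>f. f \<in> starlike_class phi_SG \<Longrightarrow>
      (\<lambda>z. f (of_real r * z) / of_real r) \<in> starlike_class phi_R"
  shows "r \<le> ln 2 / 2"
proof (rule ccontr)
  assume "\<not> r \<le> ln 2 / 2"
  \<comment> \<open>Taking t < r puts -t / r in the open disc, and t > ln 2 / 2 pushes
    \<open>phi_SG (- t)\<close> strictly below 2 sqrt 2 - 2.\<close>
  then obtain t where t: "ln 2 / 2 < t" "t < r"
    using dense[of "ln 2 / 2" r] by auto
  have t0: "t > 0"
    using t(1) by (smt (verit) ln_gt_zero divide_pos_pos)
  obtain f where f: "f \<in> starlike_class phi_SG"
    "\<And>z. z \<in> unit_disc \<Longrightarrow> star_quotient f z = phi_SG z"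
    using starlike_class_extremal[OF phi_SG_holomorphic phi_SG_0] by blast
  define z :: complex where "z = - of_real (t / r)"
  have z: "z \<in> unit_disc" "of_real r * z = - of_real t"
    using t r t0 by (simp_all add: z_def norm_divide)
  obtain \<zeta> where \<zeta>: "norm \<zeta> < 1" "star_quotient (\<lambda>z. f (of_real r * z) / of_real r) z = phi_R \<zeta>"
  proof -
    have "subordinate (star_quotient (\<lambda>z. f (of_real r * z) / of_real r)) phi_R"
      using star[OF f(1)] by (simp add: starlike_class_def)
    then obtain \<omega> where "\<omega> ` unit_disc \<subseteq> unit_disc"
      "\<forall>z\<in>unit_disc. star_quotient (\<lambda>z. f (of_real r * z) / of_real r) z = phi_R (\<omega> z)"
      unfolding subordinate_def by blast
    with z(1) show ?thesis
      by (intro that[of "\<omega> z"]) (auto simp: image_subset_iff)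
  qed
  have "f holomorphic_on unit_disc"
    using f(1) by (simp add: starlike_class_def class_A_def)
  from star_quotient_dilation[OF this r z(1)]
  have "phi_R \<zeta> = phi_SG (- of_real t)"
    using \<zeta>(2) z(2) f(2)[of "- of_real t"] t t0 r by simp
  also have "\<dots> = of_real (2 / (1 + exp t))"
    by (simp add: phi_SG_def exp_of_real)
  finally have "2 / (1 + exp t) \<ge> 2 * sqrt 2 - 2"
    by (intro phi_R_real_value_bound[OF \<zeta>(1)]) (auto intro!: divide_pos_pos add_pos_pos)
  moreover have "exp t > sqrt 2"
    using t(1) by (simp flip: exp_half_ln2)
  moreover have "2 / (1 + exp t) < 2 / (1 + sqrt 2)"
    using \<open>exp t > sqrt 2\<close> by (intro divide_strict_left_mono mult_pos_pos) (auto intro: add_pos_pos)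
  moreover have "2 / (1 + sqrt 2) = 2 * sqrt 2 - 2"
    using sqrt2_bounds by (subst divide_eq_eq) (auto simp: algebra_simps)
  ultimately show False
    by linarith
qed

theorem theorem7p10:
  "starlike_radius phi_R phi_SG = ln 2 / 2"
proof -
  \<comment> \<open>The endpoint ln 2 / 2 is itself admissible, so the supremum is attained; the
    constraint r \<le> 1 is automatic because ln 2 < 1.\<close>
  have "{r :: real. 0 < r \<and> r \<le> 1 \<and>
      (\<forall>f\<in>starlike_class phi_SG. (\<lambda>z. f (of_real r * z) / of_real r) \<in> starlike_class phi_R)}
    = {0<..ln 2 / 2}"
    using dilation_in_starlike_class radius_le ln_2_less_1 by (auto simp del: of_real_divide)
  then show ?thesis
    unfolding starlike_radius_def by simp
qed

end
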